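(* Let $A, B \in \mathbb{R}^{n \times d}$ and let $\varepsilon > 0$. For $X \in \{A, B\}$, writing $X_i$ for the $i$-th row of $X$, define $\overline{X} \in \mathbb{R}^{n\times d}$ by $\overline{X}_{ij} = X_{ij}$ if $|X_{ij}| > \frac{\varepsilon}{2}\|X_i\|_1$ and $\overline{X}_{ij} = 0$ otherwise. Then, in the entrywise $1$-norm, $$\|AB^T - \overline{A}\,\overline{B}^T\|_1 \le \varepsilon \|A\|_1\|B\|_1.$$
   Context: For a matrix $M$, $\|M\|_1 = \sum_{i,j}|M_{ij}|$ is the entrywise $1$-norm; for a vector, $\|v\|_1=\sum_i|v_i|$. *)

theory Defs
  imports "HOL-Analysis.Analysis"
begin

definition vec_norm1 :: "real ^ 'd \<Rightarrow> real" where
  "vec_norm1 v = (\<Sum>i\<in>UNIV. \<bar>v $ i\<bar>)"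

(* The entrywise 1-norm, not the operator norm induced by the vector 1-norm. *)
definition mat_norm1 :: "real ^ 'd ^ 'n \<Rightarrow> real" where
  "mat_norm1 M = (\<Sum>i\<in>UNIV. \<Sum>j\<in>UNIV. \<bar>M $ i $ j\<bar>)"

definition row_threshold :: "real \<Rightarrow> real ^ 'd ^ 'n \<Rightarrow> real ^ 'd ^ 'n" where
  "row_threshold \<epsilon> X =
     (\<chi> i j. if \<bar>X $ i $ j\<bar> > \<epsilon> / 2 * vec_norm1 (row i X) then X $ i $ j else 0)"

end

theory Submission
  imports Defs
begin

text \<open>A product \<open>A\<^sub>i\<^sub>j B\<^sub>k\<^sub>j\<close> survives in the difference only if one of its factors is
  small relative to its row, so it is at most
  \<open>\<epsilon>/2 (\<parallel>A\<^sub>i\<parallel> \<bar>B\<^sub>k\<^sub>j\<bar> + \<bar>A\<^sub>i\<^sub>j\<bar> \<parallel>B\<^sub>k\<parallel>)\<close>.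
  Summing over \<open>j\<close> bounds the \<open>(i, k)\<close> entry by \<open>\<epsilon> \<parallel>A\<^sub>i\<parallel> \<parallel>B\<^sub>k\<parallel>\<close>.\<close>

lemma mat_norm1_rows: "mat_norm1 M = (\<Sum>i\<in>UNIV. vec_norm1 (row i M))"
  by (simp add: mat_norm1_def vec_norm1_def row_def)

text \<open>If both factors survive, the difference is 0. Otherwise the truncated product vanishes
  and \<open>x * y\<close> remains, with one factor bounded by its threshold. Adding the two
  possible bounds, both nonnegative, gives one estimate for all cases.\<close>

lemma abs_diff_threshold_mult_le:
  fixes x y s t :: real
  assumes "s \<ge> 0" "t \<ge> 0"
  shows "\<bar>x * y - (if \<bar>x\<bar> > s then x else 0) * (if \<bar>y\<bar> > t then y else 0)\<bar>
           \<le> s * \<bar>y\<bar> + \<bar>x\<bar> * t"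
proof -
  have pos: "0 \<le> s * \<bar>y\<bar>" "0 \<le> \<bar>x\<bar> * t"
    using assms by simp_all
  consider "\<bar>x\<bar> > s" "\<bar>y\<bar> > t" | "\<bar>x\<bar> \<le> s" | "\<bar>y\<bar> \<le> t"
    by linarith
  then show ?thesis
  proof cases
    case 1
    then show ?thesis using pos by simp
  next
    case 2
    then have "\<bar>x\<bar> * \<bar>y\<bar> \<le> s * \<bar>y\<bar>" by (intro mult_right_mono) auto
    with 2 pos show ?thesis by (simp add: abs_mult)
  next
    case 3
    then have "\<bar>x\<bar> * \<bar>y\<bar> \<le> \<bar>x\<bar> * t" by (intro mult_left_mono) auto
    with 3 pos show ?thesis by (simp add: abs_mult)
  qed
qed

lemma abs_row_threshold_mult_entry_le:
  fixes A :: "real ^ 'd ^ 'n" and B :: "real ^ 'd ^ 'm"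
  assumes "\<epsilon> \<ge> 0"
  shows "\<bar>(A ** transpose B - row_threshold \<epsilon> A ** transpose (row_threshold \<epsilon> B)) $ i $ k\<bar>
           \<le> \<epsilon> * vec_norm1 (row i A) * vec_norm1 (row k B)"
proof -
  define s where "s = \<epsilon> / 2 * vec_norm1 (row i A)"
  define t where "t = \<epsilon> / 2 * vec_norm1 (row k B)"
  have "s \<ge> 0" "t \<ge> 0"
    using assms by (auto simp: s_def t_def vec_norm1_def intro!: mult_nonneg_nonneg sum_nonneg)
  then have "\<bar>\<Sum>j\<in>UNIV. A $ i $ j * B $ k $ j
        - (if \<bar>A $ i $ j\<bar> > s then A $ i $ j else 0) * (if \<bar>B $ k $ j\<bar> > t then B $ k $ j else 0)\<bar>
      \<le> (\<Sum>j\<in>UNIV. s * \<bar>B $ k $ j\<bar> + \<bar>A $ i $ j\<bar> * t)"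
    by (intro order_trans[OF sum_abs] sum_mono abs_diff_threshold_mult_le)
  also have "\<dots> = s * vec_norm1 (row k B) + vec_norm1 (row i A) * t"
    by (simp add: sum.distrib vec_norm1_def row_def sum_distrib_left sum_distrib_right)
  \<comment> \<open>Each term is \<open>\<epsilon> / 2\<close> times the product of the row norms;
    hence the factor 1/2 in the threshold.\<close>
  also have "\<dots> = \<epsilon> * vec_norm1 (row i A) * vec_norm1 (row k B)"
    by (simp add: s_def t_def)
  finally show ?thesis
    by (simp add: matrix_matrix_mult_def transpose_def row_threshold_def s_def t_def
        sum_subtractf)
qed

theorem theorem8:
  fixes A B :: "real ^ 'd ^ 'n" and \<epsilon> :: real
  assumes "\<epsilon> > 0"
  shows "mat_norm1 (A ** transpose B - row_threshold \<epsilon> A ** transpose (row_threshold \<epsilon> B))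
           \<le> \<epsilon> * mat_norm1 A * mat_norm1 B"
proof -
  have "mat_norm1 (A ** transpose B - row_threshold \<epsilon> A ** transpose (row_threshold \<epsilon> B))
      \<le> (\<Sum>i\<in>UNIV. \<Sum>k\<in>UNIV. \<epsilon> * vec_norm1 (row i A) * vec_norm1 (row k B))"
    unfolding mat_norm1_def using assms
    by (intro sum_mono abs_row_threshold_mult_entry_le) simp
  \<comment> \<open>The bound separates in \<open>i\<close> and \<open>k\<close>, so the double sum
    factors into two sums of row norms.\<close>
  also have "\<dots> = \<epsilon> * mat_norm1 A * mat_norm1 B"
    by (simp add: mat_norm1_rows sum_product mult.assoc flip: sum_distrib_left)
  finally show ?thesis .
qed

end
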